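(* For every stable allocation instance with rational data and a feasible rational initial allocation, random better response dynamics terminate with a stable allocation with probability one.
   Context: A stable allocation instance consists of a bipartite graph $G=(V,E)$ with color classes $J$ (jobs, the active side) and $M$ (machines, the passive side), quotas $q:V\to\mathbb{R}_{\ge 0}$, edge capacities $c:E\to\mathbb{R}_{\ge 0}$, and for every vertex $v$ a strict ranking of its incident edges. An allocation is $x:E\to\mathbb{R}_{\ge0}$ with $x(e)\le c(e)$ for all $e$ and $x(v):=\sum_{e\in\delta(v)}x(e)\le q(v)$ for all $v$. An edge $jm$ blocks $x$ if (1) $x(jm)<c(jm)$; (2) $x(j)<q(j)$ or $j$ prefers $jm$ to its worst edge with positive value in $x$; (3) $x(m)<q(m)$ or $m$ prefers $jm$ to its worst edge with positive value in $x$. An allocation is stable if no edge blocks it. A better response step: a job $j$ chooses a blocking edge $jm$ and increases $x(jm)$; simultaneously $j$ and $m$ may decrease allocation only on edges that they rank worse than $jm$, so that the result is again feasible. In the rational case, let $u>0$ be the smallest positive number representable as an integer linear combination of all input data; better response steps are restricted to those changing edge values by multiples of $u$, so that the set of reachable allocations is finite. Random better response dynamics: as long as the current allocation is unstable, the next step is chosen at random among all such (restricted) better response steps, every available step having positive probability (a discrete-time Markov chain on the finite set of reachable allocations, with stable allocations absorbing). *)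

theory Defs
  imports "HOL-Probability.Probability"
begin

type_synonym 'v edge = "'v \<times> 'v"

text \<open>
  Edges are pairs (job, machine). \<open>(e, f) \<in> prefers I v\<close> means that \<open>v\<close> ranks its
  incident edge \<open>e\<close> strictly better than its incident edge \<open>f\<close>.
\<close>

record 'v alloc_instance =
  jobs :: "'v set"
  machines :: "'v set"
  edges :: "'v edge set"
  quota :: "'v \<Rightarrow> real"
  capacity :: "'v edge \<Rightarrow> real"
  prefers :: "'v \<Rightarrow> 'v edge rel"

definition incident :: "'v alloc_instance \<Rightarrow> 'v \<Rightarrow> 'v edge set" where
  "incident I v = {e \<in> edges I. fst e = v \<or> snd e = v}"

definition stable_allocation_instance :: "'v alloc_instance \<Rightarrow> bool" where
  "stable_allocation_instance I \<longleftrightarrow>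
     finite (jobs I) \<and> finite (machines I) \<and> jobs I \<inter> machines I = {} \<and>
     edges I \<subseteq> jobs I \<times> machines I \<and>
     (\<forall>v\<in>jobs I \<union> machines I. 0 \<le> quota I v) \<and>
     (\<forall>e\<in>edges I. 0 \<le> capacity I e) \<and>
     (\<forall>v\<in>jobs I \<union> machines I.
        prefers I v \<subseteq> incident I v \<times> incident I v \<and>
        strict_linear_order_on (incident I v) (prefers I v))"

definition load :: "'v alloc_instance \<Rightarrow> ('v edge \<Rightarrow> real) \<Rightarrow> 'v \<Rightarrow> real" where
  "load I x v = (\<Sum>e\<in>incident I v. x e)"

text \<open>
  Functions on the edge set are represented by total functions that vanish on non-edges, so that
  equality of allocations is equality on the edges.
\<close>

definition allocation :: "'v alloc_instance \<Rightarrow> ('v edge \<Rightarrow> real) \<Rightarrow> bool" where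
  "allocation I x \<longleftrightarrow>
     (\<forall>e. e \<notin> edges I \<longrightarrow> x e = 0) \<and>
     (\<forall>e\<in>edges I. 0 \<le> x e \<and> x e \<le> capacity I e) \<and>
     (\<forall>v\<in>jobs I \<union> machines I. load I x v \<le> quota I v)"

definition worst_positive ::
  "'v alloc_instance \<Rightarrow> ('v edge \<Rightarrow> real) \<Rightarrow> 'v \<Rightarrow> 'v edge \<Rightarrow> bool" where
  "worst_positive I x v f \<longleftrightarrow>
     f \<in> incident I v \<and> 0 < x f \<and>
     (\<forall>g\<in>incident I v. 0 < x g \<and> g \<noteq> f \<longrightarrow> (g, f) \<in> prefers I v)"

text \<open>
  A saturated vertex without positive edges (its quota is then zero) has no worst positive edge,
  and hence does not want any edge.
\<close>

definition wants ::
  "'v alloc_instance \<Rightarrow> ('v edge \<Rightarrow> real) \<Rightarrow> 'v \<Rightarrow> 'v edge \<Rightarrow> bool" where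
  "wants I x v e \<longleftrightarrow>
     load I x v < quota I v \<or> (\<exists>f. worst_positive I x v f \<and> (e, f) \<in> prefers I v)"

definition blocks :: "'v alloc_instance \<Rightarrow> ('v edge \<Rightarrow> real) \<Rightarrow> 'v edge \<Rightarrow> bool" where
  "blocks I x e \<longleftrightarrow>
     e \<in> edges I \<and> x e < capacity I e \<and> wants I x (fst e) e \<and> wants I x (snd e) e"

definition stable_alloc :: "'v alloc_instance \<Rightarrow> ('v edge \<Rightarrow> real) \<Rightarrow> bool" where
  "stable_alloc I x \<longleftrightarrow> allocation I x \<and> \<not> (\<exists>e. blocks I x e)"

definition better_response_step ::
  "'v alloc_instance \<Rightarrow> ('v edge \<Rightarrow> real) \<Rightarrow> ('v edge \<Rightarrow> real) \<Rightarrow> bool" where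
  "better_response_step I x y \<longleftrightarrow>
     allocation I y \<and>
     (\<exists>j m. blocks I x (j, m) \<and> x (j, m) < y (j, m) \<and>
        (\<forall>e. e \<noteq> (j, m) \<longrightarrow>
           y e = x e \<or>
           y e < x e \<and> (((j, m), e) \<in> prefers I j \<or> ((j, m), e) \<in> prefers I m)))"

definition input_data :: "'v alloc_instance \<Rightarrow> ('v edge \<Rightarrow> real) \<Rightarrow> real set" where
  "input_data I x0 = quota I ` (jobs I \<union> machines I) \<union> capacity I ` edges I \<union> x0 ` edges I"

definition integer_combinations :: "real set \<Rightarrow> real set" where
  "integer_combinations D = {\<Sum>d\<in>D. of_int (k d) * d | k :: real \<Rightarrow> int. True}"

text \<open>
  For rational data the least element exists unless all data are zero; in that case all
  capacities vanish and no edge ever blocks, so that the value is irrelevant.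
\<close>

definition data_unit :: "'v alloc_instance \<Rightarrow> ('v edge \<Rightarrow> real) \<Rightarrow> real" where
  "data_unit I x0 = (LEAST u. 0 < u \<and> u \<in> integer_combinations (input_data I x0))"

definition restricted_step ::
  "'v alloc_instance \<Rightarrow> real \<Rightarrow> ('v edge \<Rightarrow> real) \<Rightarrow> ('v edge \<Rightarrow> real) \<Rightarrow> bool" where
  "restricted_step I u x y \<longleftrightarrow>
     better_response_step I x y \<and> (\<forall>e\<in>edges I. \<exists>k :: int. y e - x e = of_int k * u)"

definition reachable ::
  "'v alloc_instance \<Rightarrow> ('v edge \<Rightarrow> real) \<Rightarrow> ('v edge \<Rightarrow> real) set" where
  "reachable I x0 = {x. (restricted_step I (data_unit I x0))\<^sup>*\<^sup>* x0 x}"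

text \<open>
  The transition probabilities may depend on the current allocation in any way, as long as
  exactly the available steps have positive probability. Allocations without an available step
  are absorbing. These include all stable allocations; it is not built into the definition that
  unstable reachable allocations always have an available step.
\<close>

definition better_response_kernel ::
  "'v alloc_instance \<Rightarrow> ('v edge \<Rightarrow> real) \<Rightarrow> (('v edge \<Rightarrow> real) \<Rightarrow> ('v edge \<Rightarrow> real) pmf) \<Rightarrow> bool"
  where
  "better_response_kernel I x0 K \<longleftrightarrow>
     (\<forall>x\<in>reachable I x0.
        let S = {y. restricted_step I (data_unit I x0) x y}
        in set_pmf (K x) = (if S = {} then {x} else S))"

text \<open>
  Time-homogeneous Markov chain \<open>X\<close> on a probability space \<open>P\<close>, with state space \<open>S\<close>,
  transition kernel \<open>K\<close> and initial state \<open>s0\<close>.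
\<close>

definition markov_chain ::
  "'w measure \<Rightarrow> 's set \<Rightarrow> ('s \<Rightarrow> 's pmf) \<Rightarrow> 's \<Rightarrow> (nat \<Rightarrow> 'w \<Rightarrow> 's) \<Rightarrow> bool" where
  "markov_chain P S K s0 X \<longleftrightarrow>
     prob_space P \<and>
     (\<forall>n. X n \<in> measurable P (count_space S)) \<and>
     (AE w in P. X 0 w = s0) \<and>
     (\<forall>n s t. 0 < \<P>(w in P. \<forall>i\<le>n. X i w = s i) \<longrightarrow>
        \<P>(w in P. X (Suc n) w = t \<bar> \<forall>i\<le>n. X i w = s i) = pmf (K (s n)) t)"

definition random_better_response_dynamics ::
  "'v alloc_instance \<Rightarrow> ('v edge \<Rightarrow> real) \<Rightarrow> 'w measure \<Rightarrow>
   (nat \<Rightarrow> 'w \<Rightarrow> 'v edge \<Rightarrow> real) \<Rightarrow> bool" where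
  "random_better_response_dynamics I x0 P X \<longleftrightarrow>
     (\<exists>K. better_response_kernel I x0 K \<and> markov_chain P (reachable I x0) K x0 X)"

end

theory Submission
  imports Defs
begin

text \<open>
  All data are integer multiples of the unit \<open>u\<close>, so only finitely many allocations are
  reachable. From each of them a stable allocation can be reached by steps of size \<open>u\<close> in two
  phases. As long as some job has an edge that is open to it (below capacity and wanted by the
  machine) and that it prefers to one of its positive edges, it moves one unit to the former, and
  the machine, if saturated, drops one unit of its worst edge. Summing the job ranks of the
  allocated units, shifted so that every unit counts negatively, gives a potential that increases,
  since a dropped unit only helps. Once no such edge is left, every blocking edge starts at an
  unsaturated job. If that job plays its best blocking edge, no new open edges arise and the
  property of the first phase is preserved, while the allocation improves for the machines, so
  this phase ends as well, at a stable allocation.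

  In a finite chain where an absorbing state is accessible from everywhere, the visits to a
  transient state have finite expected number: flow into an absorbing state has total mass at
  most one, and summability travels backwards along paths. The Borel-Cantelli lemma concludes.
\<close>

lemma finite_maximizer:
  fixes F :: "'a \<Rightarrow> 'b::linorder"
  assumes "finite A" "A \<noteq> {}"
  obtains a where "a \<in> A" "\<And>b. b \<in> A \<Longrightarrow> F b \<le> F a"
proof -
  have "Max (F ` A) \<in> F ` A" using assms by simp
  then obtain a where "a \<in> A" "F a = Max (F ` A)" by auto
  then show ?thesis using that assms(1) by simp
qed

section \<open>Vertex preferences, ranks, and one-unit shifts of an allocation\<close>

locale alloc_problem =
  fixes I :: "'v alloc_instance"
  assumes inst: "stable_allocation_instance I"
begin

lemma finite_edges: "finite (edges I)"
  using inst finite_subset[of "edges I" "jobs I \<times> machines I"]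
  by (auto simp: stable_allocation_instance_def)

lemma finite_incident: "finite (incident I v)"
  using finite_edges by (simp add: incident_def)

lemma edge_cases:
  assumes "e \<in> edges I"
  shows "fst e \<in> jobs I" "snd e \<in> machines I" "fst e \<notin> machines I" "snd e \<notin> jobs I"
  using assms inst by (cases e; auto simp: stable_allocation_instance_def)+

lemma incident_job: "e \<in> incident I v \<Longrightarrow> v \<in> jobs I \<Longrightarrow> fst e = v"
  and incident_machine: "e \<in> incident I v \<Longrightarrow> v \<in> machines I \<Longrightarrow> snd e = v"
  using edge_cases[of e] by (auto simp: incident_def)

lemma prefers_incident:
  assumes "(e, f) \<in> prefers I v" "v \<in> jobs I \<union> machines I"
  shows "e \<in> incident I v" "f \<in> incident I v"
  using assms inst by (auto simp: stable_allocation_instance_def)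

lemma prefers_order:
  assumes "v \<in> jobs I \<union> machines I"
  shows prefers_trans: "(e, f) \<in> prefers I v \<Longrightarrow> (f, g) \<in> prefers I v \<Longrightarrow> (e, g) \<in> prefers I v"
    and prefers_irrefl: "(e, e) \<notin> prefers I v"
    and prefers_total: "e \<in> incident I v \<Longrightarrow> f \<in> incident I v \<Longrightarrow> e \<noteq> f \<Longrightarrow>
      (e, f) \<in> prefers I v \<or> (f, e) \<in> prefers I v"
proof -
  have "strict_linear_order_on (incident I v) (prefers I v)"
    using assms inst by (auto simp: stable_allocation_instance_def)
  then have "trans (prefers I v)" "irrefl (prefers I v)" "total_on (incident I v) (prefers I v)"
    by (auto simp: strict_linear_order_on_def)
  then show "(e, f) \<in> prefers I v \<Longrightarrow> (f, g) \<in> prefers I v \<Longrightarrow> (e, g) \<in> prefers I v"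
    and "(e, e) \<notin> prefers I v"
    and "e \<in> incident I v \<Longrightarrow> f \<in> incident I v \<Longrightarrow> e \<noteq> f \<Longrightarrow>
      (e, f) \<in> prefers I v \<or> (f, e) \<in> prefers I v"
    by (auto dest: transD irreflD simp: total_on_def)
qed

text \<open>Numerical ranks turn the choice of a best or worst edge into a finite optimisation and
  supply the weights of the potentials.\<close>

definition rank :: "'v \<Rightarrow> 'v edge \<Rightarrow> nat" where
  "rank v e = card {f. (e, f) \<in> prefers I v}"

lemma rank_less:
  assumes "(e, f) \<in> prefers I v" and v: "v \<in> jobs I \<union> machines I"
  shows "rank v f < rank v e"
  unfolding rank_def
proof (rule psubset_card_mono)
  show "finite {g. (e, g) \<in> prefers I v}"
    by (rule finite_subset[OF _ finite_incident[of v]]) (use prefers_incident(2)[OF _ v] in blast)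
  show "{g. (f, g) \<in> prefers I v} \<subset> {g. (e, g) \<in> prefers I v}"
    using assms prefers_trans[OF v] prefers_irrefl[OF v] by blast
qed

lemma rank_le:
  assumes v: "v \<in> jobs I \<union> machines I"
  shows "rank v e \<le> card (edges I)"
  unfolding rank_def
  by (rule card_mono[OF finite_edges]) (use prefers_incident(2)[OF _ v] in \<open>unfold incident_def, blast\<close>)

text \<open>\<open>wants\<close> compares only with the worst positive edge. That edge exists by
  finiteness and is \<open>g\<close> itself or ranked below \<open>g\<close>, so any worse positive
  edge is a sufficient witness.\<close>

lemma wants_if_worse_positive:
  assumes g: "0 < x g" "(e, g) \<in> prefers I v" and v: "v \<in> jobs I \<union> machines I"
  shows "wants I x v e"
proof -
  define A where "A = {f \<in> incident I v. 0 < x f}"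
  have "finite A" "g \<in> A"
    using finite_incident g prefers_incident(2)[OF g(2) v] by (auto simp: A_def)
  then obtain f where f: "f \<in> A" "\<And>h. h \<in> A \<Longrightarrow> rank v f \<le> rank v h"
    by (metis arg_min_if_finite(1) arg_min_least empty_iff)
  have worst: "(h, f) \<in> prefers I v" if "h \<in> A" "h \<noteq> f" for h
    using prefers_total[OF v, of h f] f that rank_less[OF _ v, of f h] by (fastforce simp: A_def)
  then have "worst_positive I x v f"
    using f(1) unfolding worst_positive_def A_def by blast
  moreover have "(e, f) \<in> prefers I v"
    using worst[OF \<open>g \<in> A\<close>] g prefers_trans[OF v] by (cases "g = f") auto
  ultimately show ?thesis unfolding wants_def by blast
qed

lemma wants_cong:
  assumes "\<And>f. f \<in> incident I v \<Longrightarrow> x f = y f"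
  shows "wants I x v e = wants I y v e"
proof -
  have "load I x v = load I y v" using assms by (simp add: load_def)
  moreover have "worst_positive I x v = worst_positive I y v"
    using assms by (auto simp: worst_positive_def fun_eq_iff)
  ultimately show ?thesis by (simp add: wants_def)
qed

lemma saturated_wantsE:
  assumes "wants I x v e" "\<not> load I x v < quota I v"
  obtains f where "worst_positive I x v f" "(e, f) \<in> prefers I v"
  using assms by (auto simp: wants_def)

text \<open>Every step built below has this form: \<open>a\<close> is the blocking edge and
  \<open>D\<close> holds the edges that pay for it. The corrections are additive, so linear
  functionals of the allocation change by a simple formula.\<close>

definition shift :: "real \<Rightarrow> 'v edge \<Rightarrow> 'v edge set \<Rightarrow> ('v edge \<Rightarrow> real) \<Rightarrow> 'v edge \<Rightarrow> real" where
  "shift u a D x = (\<lambda>e. x e + (if e = a then u else 0) - (if e \<in> D then u else 0))"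

text \<open>General weights let one computation serve both the loads and the two potentials.\<close>

lemma sum_shift:
  assumes "finite A"
  shows "(\<Sum>e\<in>A. w e * shift u a D x e) =
    (\<Sum>e\<in>A. w e * x e) + u * (if a \<in> A then w a else 0) - u * (\<Sum>e\<in>A \<inter> D. w e)"
proof -
  have "(\<Sum>e\<in>A. w e * shift u a D x e) =
      (\<Sum>e\<in>A. w e * x e + (if e = a then u * w e else 0) - (if e \<in> D then u * w e else 0))"
    by (rule sum.cong) (auto simp: shift_def algebra_simps)
  also have "\<dots> = (\<Sum>e\<in>A. w e * x e) + (\<Sum>e\<in>A. if e = a then u * w e else 0)
      - (\<Sum>e\<in>A. if e \<in> D then u * w e else 0)"
    by (simp add: sum.distrib sum_subtractf)
  also have "(\<Sum>e\<in>A. if e \<in> D then u * w e else 0) = u * (\<Sum>e\<in>A \<inter> D. w e)"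
    using assms by (simp add: sum.inter_restrict[symmetric] sum_distrib_left)
  also have "(\<Sum>e\<in>A. if e = a then u * w e else 0) = u * (if a \<in> A then w a else 0)"
    using assms by simp
  finally show ?thesis .
qed

lemma load_shift:
  "load I (shift u a D x) v =
    load I x v + (if a \<in> incident I v then u else 0) - u * card (incident I v \<inter> D)"
  using sum_shift[OF finite_incident, of "\<lambda>_. 1" u a D x v] by (simp add: load_def)

end

section \<open>Allocations whose values are integer multiples of the unit\<close>

locale alloc_grid = alloc_problem I for I :: "'v alloc_instance" +
  fixes u :: real
  assumes u: "0 < u"
    and quota_grid: "\<And>v. v \<in> jobs I \<union> machines I \<Longrightarrow> \<exists>k::int. quota I v = of_int k * u"
    and capacity_grid: "\<And>e. e \<in> edges I \<Longrightarrow> \<exists>k::int. capacity I e = of_int k * u"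
begin

definition grid_alloc :: "('v edge \<Rightarrow> real) \<Rightarrow> bool" where
  "grid_alloc x \<longleftrightarrow> allocation I x \<and> (\<forall>e\<in>edges I. \<exists>k::int. x e = of_int k * u)"

text \<open>On the grid a strict inequality leaves a slack of a whole unit; this is why unit shifts
  respect capacities, quotas and nonnegativity.\<close>

lemma grid_less:
  assumes "\<exists>k::int. a = of_int k * u" "\<exists>k::int. b = of_int k * u" "a < b"
  shows "a + u \<le> b"
proof -
  obtain k l :: int where kl: "a = of_int k * u" "b = of_int l * u" using assms by blast
  then have "k + 1 \<le> l" using assms(3) u by simp
  then have "of_int (k + 1) * u \<le> of_int l * u" using u by (intro mult_right_mono) auto
  with kl show ?thesis by (simp add: algebra_simps)
qed

lemma grid_sum:
  assumes "\<And>i. i \<in> A \<Longrightarrow> \<exists>k::int. f i = of_int k * u"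
  shows "\<exists>k::int. sum f A = of_int k * u"
proof -
  obtain k :: "_ \<Rightarrow> int" where "\<And>i. i \<in> A \<Longrightarrow> f i = of_int (k i) * u" using assms by metis
  then have "sum f A = of_int (sum k A) * u" by (simp add: sum_distrib_right)
  then show ?thesis by blast
qed

lemma finite_grid_allocs: "finite {x. grid_alloc x}"
proof (rule finite_subset)
  define B where "B = (\<Union>e\<in>edges I. (\<lambda>k. of_int k * u) ` {0..\<lfloor>capacity I e / u\<rfloor>})"
  show "finite {x. \<forall>e. (e \<in> edges I \<longrightarrow> x e \<in> B) \<and> (e \<notin> edges I \<longrightarrow> x e = 0)}"
    using finite_edges by (intro finite_set_of_finite_funs) (auto simp: B_def)
  show "{x. grid_alloc x} \<subseteq> {x. \<forall>e. (e \<in> edges I \<longrightarrow> x e \<in> B) \<and> (e \<notin> edges I \<longrightarrow> x e = 0)}"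
  proof clarify
    fix x e assume x: "grid_alloc x"
    have "x e \<in> B" if e: "e \<in> edges I"
    proof -
      obtain k :: int where k: "x e = of_int k * u" using x e by (auto simp: grid_alloc_def)
      have "0 \<le> of_int k * u" "of_int k * u \<le> capacity I e"
        using x e k by (auto simp: grid_alloc_def allocation_def)
      then have "0 \<le> k" "k \<le> \<lfloor>capacity I e / u\<rfloor>"
        using u by (auto simp: zero_le_mult_iff le_floor_iff field_simps)
      with e k show ?thesis unfolding B_def by (intro UN_I[of e] image_eqI[of _ _ k]) auto
    qed
    with x show "(e \<in> edges I \<longrightarrow> x e \<in> B) \<and> (e \<notin> edges I \<longrightarrow> x e = 0)"
      unfolding grid_alloc_def allocation_def by blast
  qed
qed

lemma restricted_step_grid:
  assumes "grid_alloc x" "restricted_step I u x y"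
  shows "grid_alloc y"
  unfolding grid_alloc_def
proof (intro conjI ballI)
  show "allocation I y" using assms by (simp add: restricted_step_def better_response_step_def)
  fix e assume e: "e \<in> edges I"
  obtain k l :: int where "x e = of_int k * u" "y e - x e = of_int l * u"
    using assms e unfolding grid_alloc_def restricted_step_def by meson
  then have "y e = of_int (k + l) * u" by (simp add: algebra_simps)
  then show "\<exists>k::int. y e = of_int k * u" by blast
qed

lemma restricted_steps_grid:
  assumes "(restricted_step I u)\<^sup>*\<^sup>* x y" "grid_alloc x"
  shows "grid_alloc y"
  using assms by (induction rule: rtranclp_induct) (auto intro: restricted_step_grid)

text \<open>Feasibility at \<open>j\<close> and \<open>m\<close>: an unsaturated endpoint has room
  for a whole unit, and otherwise the endpoint loses at least one unit through \<open>D\<close>. All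
  other loads can only decrease.\<close>

lemma shift_step:
  assumes x: "grid_alloc x" and a: "blocks I x (j, m)"
    and D: "\<And>f. f \<in> D \<Longrightarrow> 0 < x f \<and> (((j, m), f) \<in> prefers I j \<or> ((j, m), f) \<in> prefers I m)"
    and room: "\<And>v. v \<in> {j, m} \<Longrightarrow> load I x v < quota I v \<or> incident I v \<inter> D \<noteq> {}"
  shows "restricted_step I u x (shift u (j, m) D x)"
proof -
  let ?y = "shift u (j, m) D x"
  have alloc: "allocation I x" and grid: "\<And>e. e \<in> edges I \<Longrightarrow> \<exists>k::int. x e = of_int k * u"
    using x by (auto simp: grid_alloc_def)
  have e: "(j, m) \<in> edges I" "x (j, m) < capacity I (j, m)" using a by (auto simp: blocks_def)
  have jm: "j \<in> jobs I \<union> machines I" "m \<in> jobs I \<union> machines I" using edge_cases[OF e(1)] by auto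
  have notin: "(j, m) \<notin> D" using D prefers_irrefl jm by blast
  have D_edges: "D \<subseteq> edges I"
    using D prefers_incident(2) jm by (fastforce simp: incident_def)
  have D_ge: "u \<le> x f" if "f \<in> D" for f
    using grid_less[of 0 "x f"] grid[of f] D[OF that] D_edges that by (force intro: exI[of _ 0])
  have "allocation I ?y"
    unfolding allocation_def
  proof (intro conjI ballI allI impI)
    fix f assume "f \<notin> edges I"
    then show "?y f = 0" using alloc e D_edges by (auto simp: shift_def allocation_def simp del: split_paired_All)
  next
    fix f assume f: "f \<in> edges I"
    then have "0 \<le> x f" "x f \<le> capacity I f" using alloc by (auto simp: allocation_def)
    then show "0 \<le> ?y f" "?y f \<le> capacity I f"
      using D_ge[of f] notin u grid_less[OF grid[OF e(1)] capacity_grid[OF e(1)] e(2)]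
      by (auto simp: shift_def)
  next
    fix v assume v: "v \<in> jobs I \<union> machines I"
    have load: "load I x v \<le> quota I v" using alloc v by (auto simp: allocation_def)
    have fewer: "load I ?y v \<le> load I x v" if "(j, m) \<notin> incident I v"
      using that u by (simp add: load_shift)
    show "load I ?y v \<le> quota I v"
    proof (cases "(j, m) \<in> incident I v")
      case True
      then have "v \<in> {j, m}" by (auto simp: incident_def)
      from room[OF this] show ?thesis
      proof
        assume "load I x v < quota I v"
        then have "load I x v + u \<le> quota I v"
          using grid quota_grid[OF v]
          by (intro grid_less) (auto simp: load_def incident_def intro!: grid_sum)
        moreover have "load I ?y v \<le> load I x v + u"
          using mult_nonneg_nonneg[of u "real (card (incident I v \<inter> D))"] u True by (simp add: load_shift)
        ultimately show ?thesis by simp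
      next
        assume "incident I v \<inter> D \<noteq> {}"
        then have "1 \<le> card (incident I v \<inter> D)"
          using finite_incident by (simp add: Suc_le_eq card_gt_0_iff)
        then have "u * 1 \<le> u * card (incident I v \<inter> D)"
          using u by (intro mult_left_mono) auto
        then show ?thesis using load True by (simp add: load_shift)
      qed
    qed (use fewer load in simp)
  qed
  then have "better_response_step I x ?y"
    unfolding better_response_step_def
    using a D notin u by (intro conjI exI[of _ j] exI[of _ m]) (auto simp: shift_def)
  moreover have "\<exists>k::int. ?y f - x f = of_int k * u" for f
    using notin by (auto simp: shift_def intro: exI[of _ 0] exI[of _ 1] exI[of _ "-1"])
  ultimately show ?thesis by (simp add: restricted_step_def)
qed

section \<open>Two-phase paths to a stable allocation\<close>

definition open_edge :: "('v edge \<Rightarrow> real) \<Rightarrow> 'v edge \<Rightarrow> bool" where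
  "open_edge x e \<longleftrightarrow> e \<in> edges I \<and> x e < capacity I e \<and> wants I x (snd e) e"

text \<open>The invariant that the first phase establishes and the second one preserves.\<close>

definition no_upgrade :: "('v edge \<Rightarrow> real) \<Rightarrow> bool" where
  "no_upgrade x \<longleftrightarrow> (\<forall>e g. open_edge x e \<longrightarrow> 0 < x g \<longrightarrow> (e, g) \<notin> prefers I (fst e))"

text \<open>
  More preferred edges have larger rank. The shift makes all weights in the first potential
  negative and all weights in the second one positive.
\<close>

definition job_potential :: "('v edge \<Rightarrow> real) \<Rightarrow> real" where
  "job_potential x = (\<Sum>e\<in>edges I. (real (rank (fst e) e) - real (card (edges I)) - 1) * x e)"

definition machine_potential :: "('v edge \<Rightarrow> real) \<Rightarrow> real" where
  "machine_potential x = (\<Sum>e\<in>edges I. (real (rank (snd e) e) + 1) * x e)"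

text \<open>The job gives up a unit of \<open>g\<close> even if its quota has room: all weights are
  negative, so a pure increase would lower the potential, whereas an exchange for a better edge
  raises it.\<close>

lemma upgrade_step:
  assumes x: "grid_alloc x" and "\<not> no_upgrade x"
  obtains y where "restricted_step I u x y" "job_potential x < job_potential y"
proof -
  obtain j m g where e: "open_edge x (j, m)" and g: "0 < x g" "((j, m), g) \<in> prefers I j"
    using assms(2) by (auto simp: no_upgrade_def)
  have a: "(j, m) \<in> edges I" and wm: "wants I x m (j, m)" using e by (auto simp: open_edge_def)
  have j: "j \<in> jobs I \<union> machines I" and m: "m \<in> jobs I \<union> machines I" using edge_cases[OF a] by auto
  have blk: "blocks I x (j, m)"
    using e wants_if_worse_positive[of x, OF g j] by (auto simp: blocks_def open_edge_def)
  have "g \<in> incident I j" by (rule prefers_incident(2)[OF g(2) j])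
  then have g_inc: "g \<in> incident I j" "g \<in> edges I" "fst g = j"
    using incident_job[of g j] edge_cases(1)[OF a] by (simp_all add: incident_def)
  define w where "w e = real (rank (fst e) e) - real (card (edges I)) - 1" for e
  have pot: "job_potential (shift u (j, m) D x) =
      job_potential x + u * (w (j, m) - (\<Sum>e\<in>D. w e))" if "D \<subseteq> edges I" for D
    using sum_shift[OF finite_edges, of w u "(j, m)" D x] a that
    by (simp add: job_potential_def w_def Int_absorb1 algebra_simps)
  have wg: "w g < w (j, m)"
    using rank_less[OF g(2) j] g_inc by (simp add: w_def)
  show ?thesis
  proof (cases "load I x m < quota I m")
    case True
    have "restricted_step I u x (shift u (j, m) {g} x)"
      using g g_inc True by (intro shift_step[OF x blk]) auto
    moreover have "job_potential x < job_potential (shift u (j, m) {g} x)"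
      using pot[of "{g}"] g_inc wg u by simp
    ultimately show ?thesis by (rule that)
  next
    case False
    obtain f where f: "worst_positive I x m f" "((j, m), f) \<in> prefers I m"
      by (rule saturated_wantsE[OF wm False])
    have f_inc: "f \<in> incident I m" "f \<in> edges I" "0 < x f"
      using f(1) by (auto simp: worst_positive_def incident_def)
    have "restricted_step I u x (shift u (j, m) {g, f} x)"
      using g g_inc f f_inc by (intro shift_step[OF x blk]) auto
    \<comment> \<open>Distinctness gives the sum over \<open>{g, f}\<close> two terms. A common edge
      would join \<open>j\<close> to \<open>m\<close>, hence be the blocking edge, which is not
      worse than itself.\<close>
    moreover have "f \<noteq> g"
    proof
      assume "f = g"
      then have "f = (j, m)"
        using g_inc(3) incident_machine[OF f_inc(1)] edge_cases(2)[OF a] by (simp add: prod_eq_iff)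
      with f prefers_irrefl[OF m] show False by simp
    qed
    moreover have "w f < 0"
      using rank_le[of "fst f" f] edge_cases[OF f_inc(2)] by (simp add: w_def)
    ultimately show ?thesis
      using pot[of "{g, f}"] g_inc f_inc wg u by (intro that) auto
  qed
qed

text \<open>The invariant makes every job with a blocking edge unsaturated, so the job drops
  nothing. The machine either gains a unit or exchanges its worst unit for a better one, which
  raises the potential.\<close>

lemma best_response_step:
  assumes x: "grid_alloc x" and nu: "no_upgrade x" and "blocks I x b"
  obtains y where "restricted_step I u x y" "no_upgrade y" "machine_potential x < machine_potential y"
proof -
  define j where "j = fst b"
  define A where "A = {e. blocks I x e \<and> fst e = j}"
  have "finite A" "A \<noteq> {}"
    using finite_subset[OF _ finite_edges, of A] assms(3) unfolding A_def blocks_def j_def by blast+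
  then obtain a where "a \<in> A" and best: "\<And>e. e \<in> A \<Longrightarrow> rank j e \<le> rank j a"
    using finite_maximizer[of A "rank j"] by blast
  then obtain m where am: "a = (j, m)" and blk: "blocks I x (j, m)"
    by (cases a) (auto simp: A_def)
  have a: "(j, m) \<in> edges I" and wm: "wants I x m (j, m)" and wj: "wants I x j (j, m)"
    using blk by (auto simp: blocks_def)
  have open_a: "open_edge x (j, m)" using blk by (auto simp: blocks_def open_edge_def)
  have j: "j \<in> jobs I \<union> machines I" and m: "m \<in> jobs I \<union> machines I" using edge_cases[OF a] by auto
  \<comment> \<open>A saturated job would want the edge only because of a worse positive edge, which
    the invariant excludes for open edges.\<close>
  have unsat: "load I x j < quota I j"
    using wj nu open_a by (auto simp: wants_def worst_positive_def no_upgrade_def)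
  define w where "w e = real (rank (snd e) e) + 1" for e
  have pot: "machine_potential (shift u (j, m) D x) =
      machine_potential x + u * (w (j, m) - (\<Sum>e\<in>D. w e))" if "D \<subseteq> edges I" for D
    using sum_shift[OF finite_edges, of w u "(j, m)" D x] a that
    by (simp add: machine_potential_def w_def Int_absorb1 algebra_simps)
  obtain D where D_worst: "\<And>f. f \<in> D \<Longrightarrow> worst_positive I x m f \<and> ((j, m), f) \<in> prefers I m"
    and D: "(load I x m < quota I m \<and> D = {}) \<or> (\<not> load I x m < quota I m \<and> (\<exists>f. D = {f}))"
  proof (cases "load I x m < quota I m")
    case True
    then show ?thesis using that[of "{}"] by auto
  next
    case False
    then show ?thesis
      using saturated_wantsE[OF wm False] that by (metis singletonD)
  qed
  have D_inc: "f \<in> incident I m" "f \<in> edges I" "snd f = m" "0 < x f" if "f \<in> D" for f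
    using D_worst[OF that] incident_machine[of f m] edge_cases(2)[OF a]
    by (simp_all add: worst_positive_def incident_def)
  define y where "y = shift u (j, m) D x"
  have notin: "(j, m) \<notin> D" using D_worst prefers_irrefl[OF m] by blast
  have step: "restricted_step I u x y"
    unfolding y_def using D_worst D_inc D unsat by (intro shift_step[OF x blk]) auto
  have "machine_potential x < machine_potential y"
  proof -
    have "(\<Sum>e\<in>D. w e) < w (j, m)"
      using D D_worst D_inc rank_less[OF _ m] by (auto simp: w_def)
    moreover have "D \<subseteq> edges I" using D_inc(2) by blast
    ultimately show ?thesis using pot[of D] u by (simp add: y_def)
  qed
  \<comment> \<open>Only the machine \<open>m\<close> is affected. With free quota it wanted
    everything before. If it was saturated, its load is unchanged and its worst positive edge is now
    \<open>f\<close> or a better one, so whatever it wants now already beat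
    \<open>f\<close>.\<close>
  moreover have open_mono: "open_edge x e" if "open_edge y e" for e
  proof -
    have e: "e \<in> edges I" "y e < capacity I e" "wants I y (snd e) e"
      using that by (auto simp: open_edge_def)
    consider "snd e \<noteq> m" | "snd e = m" "load I x m < quota I m" "D = {}"
      | f where "snd e = m" "\<not> load I x m < quota I m" "D = {f}"
      using D by blast
    then show ?thesis
    proof cases
      case 1
      have same: "y h = x h" if "h \<in> incident I (snd e)" for h
        using incident_machine[OF that edge_cases(2)[OF e(1)]] 1 D_inc(3)[of h]
        by (auto simp: y_def shift_def)
      then have "wants I x (snd e) e" using e(3) wants_cong[of "snd e" y x e] by simp
      moreover have "y e = x e" using same[of e] e(1) by (simp add: incident_def)
      ultimately show ?thesis using e by (simp add: open_edge_def)
    next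
      case 2
      then show ?thesis using e u by (auto simp: open_edge_def wants_def y_def shift_def split: if_splits)
    next
      case 3
      then have f: "worst_positive I x m f" "((j, m), f) \<in> prefers I m" using D_worst by auto
      have "load I y m = load I x m"
        using 3 a f by (auto simp: y_def load_shift incident_def worst_positive_def)
      then obtain f' where f': "worst_positive I y m f'" "(e, f') \<in> prefers I m"
        using saturated_wantsE[of y m e] e 3 by metis
      have "f' = f \<or> (f', f) \<in> prefers I m"
      \<comment> \<open>The edge \<open>(j, m)\<close> is separate because it may have been zero in
        \<open>x\<close>.\<close>
      proof (cases "f' = (j, m)")
        case False
        then have "0 < x f'" "f' \<in> incident I m"
          using f' u by (auto simp: worst_positive_def y_def shift_def split: if_splits)
        then show ?thesis using f(1) by (auto simp: worst_positive_def)
      qed (use f in simp)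
      then have ef: "(e, f) \<in> prefers I m" using f' prefers_trans[OF m] by blast
      then have "e \<notin> D" using 3 prefers_irrefl[OF m] by blast
      then have "x e \<le> y e" using u by (simp add: y_def shift_def)
      moreover have "wants I x (snd e) e" unfolding wants_def 3 using f(1) ef by blast
      ultimately show ?thesis using e by (simp add: open_edge_def)
    qed
  qed
  have "no_upgrade y"
    unfolding no_upgrade_def
  proof (intro allI impI notI)
    fix e g assume e: "open_edge y e" and g: "0 < y g" "(e, g) \<in> prefers I (fst e)"
    have open_x: "open_edge x e" using open_mono[OF e] .
    then have e_edge: "e \<in> edges I" by (simp add: open_edge_def)
    \<comment> \<open>The old invariant leaves only the edge that gained a unit as \<open>g\<close>.
      Then \<open>e\<close> already blocked \<open>x\<close>, since \<open>j\<close> had free quota,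
      and this contradicts the choice of \<open>a\<close> as best.\<close>
    have "\<not> 0 < x g" using nu open_x g(2) unfolding no_upgrade_def by blast
    then have "g = (j, m)" using g(1) u by (auto simp: y_def shift_def split: if_splits)
    moreover have "fst e \<in> jobs I \<union> machines I" using edge_cases[OF e_edge] by simp
    ultimately have "fst e = j"
      using incident_job[OF prefers_incident(2)[OF g(2)]] edge_cases(1)[OF e_edge] by simp
    then have "e \<in> A" using open_x unsat by (auto simp: A_def blocks_def open_edge_def wants_def)
    with best[OF this] rank_less[OF g(2)] \<open>g = (j, m)\<close> \<open>fst e = j\<close> j am show False by auto
  qed
  ultimately show ?thesis using step that by blast
qed

text \<open>Maximisers over the finite set of reachable allocations replace an iteration of steps:
  first of the job potential, which yields the invariant, then of the machine potential among those
  with the invariant.\<close>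

lemma reaches_stable:
  assumes "grid_alloc x"
  shows "\<exists>z. (restricted_step I u)\<^sup>*\<^sup>* x z \<and> stable_alloc I z"
proof -
  define A where "A = {y. (restricted_step I u)\<^sup>*\<^sup>* x y}"
  have A: "A \<subseteq> {x. grid_alloc x}" using restricted_steps_grid assms by (auto simp: A_def)
  then have fin: "finite A" by (rule finite_subset[OF _ finite_grid_allocs])
  have A_step: "z \<in> A" if "y \<in> A" "restricted_step I u y z" for y z
    using that by (auto simp: A_def)
  have "A \<noteq> {}" by (auto simp: A_def)
  with fin obtain y where y: "y \<in> A" "\<And>z. z \<in> A \<Longrightarrow> job_potential z \<le> job_potential y"
    by (rule finite_maximizer[where F = job_potential]) blast
  have "no_upgrade y"
  proof (rule ccontr)
    assume "\<not> no_upgrade y"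
    with y A obtain z where "restricted_step I u y z" "job_potential y < job_potential z"
      using upgrade_step by blast
    with y A_step show False by fastforce
  qed
  define B where "B = {t \<in> A. no_upgrade t}"
  have "finite B" "B \<noteq> {}" using fin y \<open>no_upgrade y\<close> by (auto simp: B_def)
  then obtain z where "z \<in> B" and max: "\<And>t. t \<in> B \<Longrightarrow> machine_potential t \<le> machine_potential z"
    by (rule finite_maximizer[where F = machine_potential]) blast
  then have z: "z \<in> A" "no_upgrade z" by (auto simp: B_def)
  have "\<not> blocks I z b" for b
  proof
    assume "blocks I z b"
    with z A obtain t where "restricted_step I u z t" "no_upgrade t"
        "machine_potential z < machine_potential t"
      using best_response_step by blast
    with max[of t] A_step[OF z(1)] show False by (auto simp: B_def)
  qed
  with z A show ?thesis by (auto simp: stable_alloc_def A_def grid_alloc_def)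
qed

end

section \<open>Absorption in finite Markov chains\<close>

text \<open>The chain is specified by conditioning on full histories. Summing over the finitely many
  histories that end in \<open>s\<close> leaves a condition on the present state only.\<close>

lemma markov_chain_two_step:
  assumes mc: "markov_chain P S K s0 X" and fin: "finite S"
  shows "\<P>(w in P. X n w = s \<and> X (Suc n) w = t) = \<P>(w in P. X n w = s) * pmf (K s) t"
proof -
  interpret prob_space P using mc by (simp add: markov_chain_def)
  have X: "X i \<in> measurable P (count_space S)" for i
    using mc by (simp add: markov_chain_def)
  have XS: "X i w \<in> S" if "w \<in> space P" for i w
    using measurable_space[OF X that] by simp
  have pred[measurable]: "Measurable.pred P (\<lambda>w. X i w = a)" for i a
    by (rule measurable_compose[OF X]) simp
  \<comment> \<open>Extensional functions make distinct histories differ at some time up to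
    \<open>n\<close>, so their events are disjoint.\<close>
  define H where "H = {h \<in> {..n} \<rightarrow>\<^sub>E S. h n = s}"
  have finH: "finite H"
    unfolding H_def by (rule finite_subset[OF _ finite_PiE[of "{..n}" "\<lambda>_. S"]]) (use fin in auto)
  have decomp: "\<P>(w in P. X n w = s \<and> Q w) = (\<Sum>h\<in>H. \<P>(w in P. (\<forall>i\<le>n. X i w = h i) \<and> Q w))"
    if Q[measurable]: "Measurable.pred P Q" for Q
  proof -
    have "{w \<in> space P. X n w = s \<and> Q w} = (\<Union>h\<in>H. {w \<in> space P. (\<forall>i\<le>n. X i w = h i) \<and> Q w})"
    proof (intro equalityI subsetI)
      fix w assume w: "w \<in> {w \<in> space P. X n w = s \<and> Q w}"
      then have "restrict (\<lambda>i. X i w) {..n} \<in> H"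
        by (auto simp: H_def XS)
      with w show "w \<in> (\<Union>h\<in>H. {w \<in> space P. (\<forall>i\<le>n. X i w = h i) \<and> Q w})"
        by (intro UN_I[of "restrict (\<lambda>i. X i w) {..n}"]) auto
    qed (auto simp: H_def)
    moreover have "disjoint_family_on (\<lambda>h. {w \<in> space P. (\<forall>i\<le>n. X i w = h i) \<and> Q w}) H"
      unfolding disjoint_family_on_def
    proof (intro ballI impI)
      fix g h assume gh: "g \<in> H" "h \<in> H" "g \<noteq> h"
      then obtain i where "i \<le> n" "g i \<noteq> h i"
        unfolding H_def by (metis (mono_tags, lifting) PiE_ext atMost_iff mem_Collect_eq)
      then show "{w \<in> space P. (\<forall>i\<le>n. X i w = g i) \<and> Q w} \<inter>
          {w \<in> space P. (\<forall>i\<le>n. X i w = h i) \<and> Q w} = {}"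
        by auto
    qed
    ultimately show ?thesis
      using finite_measure_finite_Union[OF finH, of "\<lambda>h. {w \<in> space P. (\<forall>i\<le>n. X i w = h i) \<and> Q w}"]
      by (auto simp: image_subset_iff)
  qed
  have step: "\<P>(w in P. (\<forall>i\<le>n. X i w = h i) \<and> X (Suc n) w = t)
      = \<P>(w in P. (\<forall>i\<le>n. X i w = h i) \<and> True) * pmf (K s) t" if "h \<in> H" for h
  proof (cases "\<P>(w in P. \<forall>i\<le>n. X i w = h i) = 0")
    \<comment> \<open>A null history lies outside the specification of the chain, but both sides
      then vanish.\<close>
    case True
    have "\<P>(w in P. (\<forall>i\<le>n. X i w = h i) \<and> X (Suc n) w = t) \<le> \<P>(w in P. \<forall>i\<le>n. X i w = h i)"
      by (rule finite_measure_mono) auto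
    with True show ?thesis
      using measure_nonneg[of P "{w \<in> space P. (\<forall>i\<le>n. X i w = h i) \<and> X (Suc n) w = t}"] by simp
  next
    case False
    then have pos: "0 < \<P>(w in P. \<forall>i\<le>n. X i w = h i)"
      by (simp add: zero_less_measure_iff)
    have "h n = s" using that by (simp add: H_def)
    then have "\<P>(w in P. X (Suc n) w = t \<bar> \<forall>i\<le>n. X i w = h i) = pmf (K s) t"
      using mc pos by (auto simp: markov_chain_def)
    with pos show ?thesis
      by (simp add: cond_prob_def field_simps conj_commute)
  qed
  show ?thesis
    using decomp[of "\<lambda>w. X (Suc n) w = t"] decomp[of "\<lambda>_. True"] step
    by (simp add: sum_distrib_right)
qed

lemma markov_chain_absorbed:
  assumes mc: "markov_chain P S K s0 X" and fin: "finite S"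
    and absorbing: "\<And>t. t \<in> T \<Longrightarrow> pmf (K t) t = 1"
    and path: "\<And>s. s \<in> S \<Longrightarrow> \<exists>t\<in>T. (\<lambda>a b. 0 < pmf (K a) b)\<^sup>*\<^sup>* s t"
  shows "AE w in P. \<exists>n. X n w \<in> T \<and> (\<forall>k\<ge>n. X k w = X n w)"
proof -
  interpret prob_space P using mc by (simp add: markov_chain_def)
  have X: "X i \<in> measurable P (count_space S)" for i
    using mc by (simp add: markov_chain_def)
  have XS: "X i w \<in> S" if "w \<in> space P" for i w
    using measurable_space[OF X that] by simp
  have pred[measurable]: "Measurable.pred P (\<lambda>w. X i w = a)" for i a
    by (rule measurable_compose[OF X]) simp
  define p where "p n s = \<P>(w in P. X n w = s)" for n s
  have p0: "0 \<le> p n s" and p1: "p n s \<le> 1" for n s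
    by (auto simp: p_def)
  note two_step = markov_chain_two_step[OF mc fin, folded p_def]
  have flow: "p n s * pmf (K s) t \<le> p (Suc n) t" for n s t
    by (simp only: two_step[symmetric], simp only: p_def, rule finite_measure_mono) auto
  \<comment> \<open>Mass in an absorbing state stays there, and mass arriving from another state
    comes on top.\<close>
  have flow_absorbing: "p n t + p n s * pmf (K s) t \<le> p (Suc n) t" if "t \<in> T" "s \<noteq> t" for n s t
  proof -
    have "p n t + p n s * pmf (K s) t =
        \<P>(w in P. X n w = t \<and> X (Suc n) w = t) + \<P>(w in P. X n w = s \<and> X (Suc n) w = t)"
      by (simp add: two_step absorbing that)
    also have "\<dots> = measure P ({w \<in> space P. X n w = t \<and> X (Suc n) w = t} \<union>
        {w \<in> space P. X n w = s \<and> X (Suc n) w = t})"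
      using that by (intro finite_measure_Union[symmetric]) auto
    also have "\<dots> \<le> p (Suc n) t"
      unfolding p_def by (rule finite_measure_mono) auto
    finally show ?thesis .
  qed
  \<comment> \<open>Backward induction along a path to \<open>T\<close>. States in \<open>T\<close>
    may keep positive mass forever, hence the disjunction.\<close>
  have summable: "s \<in> T \<or> summable (\<lambda>n. p n s)"
    if "(\<lambda>a b. 0 < pmf (K a) b)\<^sup>*\<^sup>* s t" "t \<in> T" for s t
    using that
  proof (induction rule: converse_rtranclp_induct)
    case base
    then show ?case by simp
  next
    case (step s r)
    define c where "c = pmf (K s) r"
    have c: "0 < c" using step by (simp add: c_def)
    show ?case
    proof (cases "s \<in> T")
      case False
      have "summable (\<lambda>n. p n s * c)"
      proof (cases "r \<in> T")
        case True
        with False have "s \<noteq> r" by auto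
        \<comment> \<open>What has flowed from \<open>s\<close> into the absorbing state
          \<open>r\<close> is still there at time \<open>n\<close>, so the partial sums are at most
          one.\<close>
        have "(\<Sum>i<n. p i s * c) \<le> p n r" for n
          by (induction n) (use flow_absorbing[OF True \<open>s \<noteq> r\<close>] p0 in \<open>auto simp: c_def intro: order_trans[OF add_right_mono]\<close>)
        then have "(\<Sum>i<n. p i s * c) \<le> 1" for n
          using p1 order_trans by blast
        then show ?thesis
          using p0 c by (intro summableI_nonneg_bounded[where x = 1]) auto
      next
        \<comment> \<open>For \<open>r\<close> outside \<open>T\<close>, the mass
          \<open>p n s * c\<close> arrives in \<open>r\<close> one step later, and the masses at
          \<open>r\<close> are summable by induction.\<close>
        case False
        then have "summable (\<lambda>n. p (Suc n) r)"
          using step summable_Suc_iff[of "\<lambda>n. p n r"] by simp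
        then show ?thesis
          by (rule summable_comparison_test'[where N = 0]) (use flow p0 c in \<open>auto simp: c_def\<close>)
      qed
      then have "summable (\<lambda>n. p n s * c / c)" by (rule summable_divide)
      then show ?thesis using c by simp
    qed simp
  qed
  have transient: "AE w in P. \<forall>s\<in>S - T. eventually (\<lambda>n. X n w \<noteq> s) sequentially"
  proof (rule AE_finite_allI)
    show "finite (S - T)" using fin by simp
    fix s assume s: "s \<in> S - T"
    then have "summable (\<lambda>n. p n s)"
      using path[of s] summable by blast
    then have "AE w in P. eventually (\<lambda>n. w \<in> space P - {w \<in> space P. X n w = s}) sequentially"
      unfolding p_def by (intro borel_cantelli_AE1) (auto simp: emeasure_eq_measure)
    then show "AE w in P. eventually (\<lambda>n. X n w \<noteq> s) sequentially"
      by (rule AE_mp) (auto elim: eventually_mono)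
  qed
  \<comment> \<open>The event of staying in \<open>t\<close> has the full probability of being in
    \<open>t\<close>, so leaving is a null event.\<close>
  have "AE w in P. X n w = t \<longrightarrow> X (Suc n) w = t" if "t \<in> T" for n t
  proof -
    have "{w \<in> space P. X n w = t} = {w \<in> space P. X n w = t \<and> X (Suc n) w = t} \<union>
        {w \<in> space P. \<not> (X n w = t \<longrightarrow> X (Suc n) w = t)}"
      by auto
    also have "prob \<dots> = \<P>(w in P. X n w = t \<and> X (Suc n) w = t) +
        \<P>(w in P. \<not> (X n w = t \<longrightarrow> X (Suc n) w = t))"
      by (rule finite_measure_Union) auto
    finally have "\<P>(w in P. \<not> (X n w = t \<longrightarrow> X (Suc n) w = t)) = 0"
      using two_step[of n t t] absorbing[OF that] by (simp add: p_def)
    then show ?thesis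
      by (subst AE_iff_measurable[OF _ refl]) (auto simp: emeasure_eq_measure)
  qed
  then have "AE w in P. \<forall>t\<in>S \<inter> T. \<forall>n. X n w = t \<longrightarrow> X (Suc n) w = t"
    using fin by (intro AE_finite_allI) (auto simp: AE_all_countable)
  then show ?thesis
    using transient AE_space
  proof eventually_elim
    case (elim w)
    \<comment> \<open>Finitely many transient states have a common time from which none is visited,
      so the chain then sits in an absorbing state.\<close>
    have "eventually (\<lambda>n. \<forall>s\<in>S - T. X n w \<noteq> s) sequentially"
      using elim fin by (intro eventually_ball_finite) auto
    then obtain n where "\<forall>s\<in>S - T. X n w \<noteq> s"
      by (auto simp: eventually_sequentially)
    then have n: "X n w \<in> S \<inter> T"
      using XS[OF \<open>w \<in> space P\<close>] by blast
    have "X k w = X n w" if "n \<le> k" for k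
      using that by (induction rule: dec_induct) (use n elim in auto)
    with n show ?case by blast
  qed
qed

section \<open>The unit of rational data\<close>

text \<open>Serves both a change of sign and division with remainder.\<close>

lemma integer_combinations_diff:
  assumes "a \<in> integer_combinations D" "b \<in> integer_combinations D"
  shows "a - of_int n * b \<in> integer_combinations D"
proof -
  obtain k l :: "real \<Rightarrow> int" where "a = (\<Sum>d\<in>D. of_int (k d) * d)" "b = (\<Sum>d\<in>D. of_int (l d) * d)"
    using assms by (auto simp: integer_combinations_def)
  then have "a - of_int n * b = (\<Sum>d\<in>D. of_int (k d - n * l d) * d)"
    by (simp add: sum_subtractf sum_distrib_left algebra_simps)
  then show ?thesis unfolding integer_combinations_def by (intro CollectI exI[of _ "\<lambda>d. k d - n * l d"]) simp
qed

lemma integer_combinations_superset: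
  assumes "finite D" "d \<in> D"
  shows "d \<in> integer_combinations D"
proof -
  have "(\<Sum>e\<in>D. of_int (if e = d then 1 else 0) * e) = (\<Sum>e\<in>D. if e = d then e else 0)"
    by (rule sum.cong) auto
  also have "\<dots> = d" using assms by simp
  finally show ?thesis
    unfolding integer_combinations_def by (intro CollectI exI[of _ "\<lambda>e. if e = d then 1 else 0"]) simp
qed

lemma rational_common_denominator:
  assumes "finite D" "D \<subseteq> \<rat>"
  obtains N :: nat where "0 < N" "\<And>d::real. d \<in> D \<Longrightarrow> of_nat N * d \<in> \<int>"
proof -
  have "\<exists>N::nat. 0 < N \<and> (\<forall>d\<in>D. of_nat N * d \<in> \<int>)"
    using assms
  proof (induction rule: finite_induct)
    case (insert d D)
    then obtain N :: nat where N: "0 < N" "\<forall>d\<in>D. of_nat N * d \<in> \<int>" by auto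
    obtain a b :: int where ab: "b \<noteq> 0" "d = of_int a / of_int b"
      using insert.prems Rats_cases'[of d] by (metis insert_subset less_irrefl)
    define M where "M = N * nat \<bar>b\<bar>"
    have M: "real M = real N * \<bar>of_int b\<bar>" by (simp add: M_def)
    have "real M * d = of_int (int N * (sgn b * a))"
      unfolding M using ab by (simp add: sgn_if abs_if)
    then have "real M * d \<in> \<int>" by (metis Ints_of_int)
    moreover have "real M * e \<in> \<int>" if "e \<in> D" for e
    proof -
      have "real M * e = of_int \<bar>b\<bar> * (real N * e)" by (simp add: M)
      then show ?thesis using N(2) that by (metis Ints_mult Ints_of_int)
    qed
    moreover have "0 < M" using N(1) ab(1) by (simp add: M_def)
    ultimately show ?case by blast
  qed auto
  then show ?thesis using that by blast
qed

text \<open>A common denominator maps all combinations to integers, so a least positive one exists;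
  the nonzero datum \<open>a\<close> ensures that there are positive ones. The remainder of a datum
  modulo the least one is a smaller nonnegative combination, hence zero.\<close>

lemma least_integer_combination:
  fixes D :: "real set"
  defines "u \<equiv> (LEAST u. 0 < u \<and> u \<in> integer_combinations D)"
  assumes D: "finite D" "D \<subseteq> \<rat>" and a: "a \<in> D" "a \<noteq> 0"
  shows "0 < u" and "d \<in> D \<Longrightarrow> \<exists>k::int. d = of_int k * u"
proof -
  obtain N :: nat where N: "0 < N" "\<And>d. d \<in> D \<Longrightarrow> of_nat N * d \<in> \<int>"
    using rational_common_denominator[OF D] by blast
  have int: "of_nat N * h \<in> \<int>" if "h \<in> integer_combinations D" for h
  proof -
    obtain k :: "real \<Rightarrow> int" where "h = (\<Sum>d\<in>D. of_int (k d) * d)"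
      using \<open>h \<in> integer_combinations D\<close> by (auto simp: integer_combinations_def)
    then have "of_nat N * h = (\<Sum>d\<in>D. of_int (k d) * (of_nat N * d))"
      by (simp add: sum_distrib_left mult.left_commute)
    also have "\<dots> \<in> \<int>" by (intro Ints_sum Ints_mult Ints_of_int N(2))
    finally show ?thesis .
  qed
  define H where "H = {h. 0 < h \<and> h \<in> integer_combinations D}"
  have "\<bar>a\<bar> \<in> H"
  proof -
    have "a \<in> integer_combinations D" by (rule integer_combinations_superset[OF D(1) a(1)])
    \<comment> \<open>For negative \<open>a\<close>, the combination \<open>a - 2 * a\<close> is
      \<open>- a\<close>.\<close>
    then show ?thesis
      using integer_combinations_diff[of a D a 2] a(2) by (auto simp: H_def abs_if)
  qed
  \<comment> \<open>On \<open>H\<close> the product with \<open>N\<close> is a positive integer, so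
    floor and \<open>nat\<close> lose nothing and the well-ordering of the naturals applies.\<close>
  then obtain h where h: "h \<in> H" and min: "\<And>g. g \<in> H \<Longrightarrow> nat \<lfloor>of_nat N * h\<rfloor> \<le> nat \<lfloor>of_nat N * g\<rfloor>"
    using ex_has_least_nat[of "\<lambda>h. h \<in> H" "\<bar>a\<bar>" "\<lambda>h. nat \<lfloor>of_nat N * h\<rfloor>"] by blast
  have least: "h \<le> g" if "g \<in> H" for g
  proof -
    obtain k l :: int where kl: "of_nat N * h = of_int k" "of_nat N * g = of_int l"
      using int[of h] int[of g] h \<open>g \<in> H\<close> unfolding H_def by (blast elim: Ints_cases)
    have "0 < of_nat N * g" using N(1) that by (simp add: H_def)
    then have "0 < l" using kl by simp
    then have "k \<le> l" using min[OF that] kl by (simp add: nat_le_eq_zle)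
    then have "of_nat N * h \<le> of_nat N * g" using kl by simp
    then show ?thesis using N(1) by simp
  qed
  have "u = h"
    unfolding u_def by (rule Least_equality) (use h least in \<open>auto simp: H_def\<close>)
  then have u: "0 < u" "u \<in> integer_combinations D" "\<And>g. g \<in> H \<Longrightarrow> u \<le> g"
    using h least by (auto simp: H_def)
  then show "0 < u" by simp
  show "\<exists>k::int. d = of_int k * u" if "d \<in> D"
  proof -
    define r where "r = d - of_int \<lfloor>d / u\<rfloor> * u"
    have "r \<in> integer_combinations D"
      unfolding r_def using integer_combinations_superset[OF D(1) that] u(2) by (rule integer_combinations_diff)
    moreover have "0 \<le> r" "r < u"
      using floor_divide_lower[OF u(1), of d] floor_divide_upper[OF u(1), of d]
      by (auto simp: r_def algebra_simps)
    ultimately have "r = 0" using u(3)[of r] by (force simp: H_def)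
    then show ?thesis by (auto simp: r_def)
  qed
qed

section \<open>Convergence of the dynamics\<close>

lemma finite_input_data:
  assumes "stable_allocation_instance I"
  shows "finite (input_data I x0)"
  using assms alloc_problem.finite_edges[of I] by (simp add: alloc_problem_def input_data_def stable_allocation_instance_def)

lemma reachable_finite_and_stabilizing:
  assumes inst: "stable_allocation_instance I" and x0: "allocation I x0" and rat: "input_data I x0 \<subseteq> \<rat>"
  shows "finite (reachable I x0)"
    and "x \<in> reachable I x0 \<Longrightarrow>
      \<exists>z. (restricted_step I (data_unit I x0))\<^sup>*\<^sup>* x z \<and> stable_alloc I z"
proof -
  define u where "u = data_unit I x0"
  have "finite (reachable I x0) \<and>
      (\<forall>x\<in>reachable I x0. \<exists>z. (restricted_step I u)\<^sup>*\<^sup>* x z \<and> stable_alloc I z)"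
  \<comment> \<open>The unit is meaningful only if some datum is nonzero. If all capacities vanish,
    no edge blocks and no step leaves \<open>x0\<close>; otherwise a nonzero capacity is such a
    datum.\<close>
  proof (cases "\<forall>e\<in>edges I. capacity I e = 0")
    case True
    then have "\<not> blocks I x0 e" for e
      using x0 by (fastforce simp: blocks_def allocation_def)
    then have stable: "stable_alloc I x0" and no_step: "\<not> restricted_step I u x0 y" for y
      using x0 by (auto simp: stable_alloc_def restricted_step_def better_response_step_def)
    then have "reachable I x0 = {x0}"
      unfolding reachable_def u_def[symmetric] by (auto elim: converse_rtranclpE)
    with stable show ?thesis by auto
  next
    case False
    then obtain e where "e \<in> edges I" "capacity I e \<noteq> 0" by blast
    moreover have "capacity I e \<in> input_data I x0" using \<open>e \<in> edges I\<close> by (simp add: input_data_def)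
    ultimately have u: "0 < u" and grid: "\<And>d. d \<in> input_data I x0 \<Longrightarrow> \<exists>k::int. d = of_int k * u"
      using least_integer_combination[OF finite_input_data[OF inst] rat]
      unfolding u_def data_unit_def by blast+
    have quota: "\<And>v. v \<in> jobs I \<union> machines I \<Longrightarrow> \<exists>k::int. quota I v = of_int k * u"
      and capacity: "\<And>e. e \<in> edges I \<Longrightarrow> \<exists>k::int. capacity I e = of_int k * u"
      and "\<And>e. e \<in> edges I \<Longrightarrow> \<exists>k::int. x0 e = of_int k * u"
      by (rule grid; auto simp: input_data_def)+
    interpret alloc_grid I u
      by unfold_locales (fact inst u quota capacity)+
    have "grid_alloc x0"
      using x0 \<open>\<And>e. e \<in> edges I \<Longrightarrow> \<exists>k::int. x0 e = of_int k * u\<close> by (simp add: grid_alloc_def)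
    then have grid_reachable: "reachable I x0 \<subseteq> {x. grid_alloc x}"
      using restricted_steps_grid by (auto simp: reachable_def u_def)
    then have "finite (reachable I x0)"
      by (rule finite_subset[OF _ finite_grid_allocs])
    then show ?thesis using reaches_stable grid_reachable by auto
  qed
  then show "finite (reachable I x0)"
    and "x \<in> reachable I x0 \<Longrightarrow>
      \<exists>z. (restricted_step I (data_unit I x0))\<^sup>*\<^sup>* x z \<and> stable_alloc I z"
    by (auto simp: u_def)
qed

theorem theorem3:
  fixes I :: "'v alloc_instance"
    and x0 :: "'v edge \<Rightarrow> real"
    and P :: "'w measure"
    and X :: "nat \<Rightarrow> 'w \<Rightarrow> 'v edge \<Rightarrow> real"
  assumes "stable_allocation_instance I"
    and "allocation I x0"
    and "input_data I x0 \<subseteq> \<rat>"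
    and "random_better_response_dynamics I x0 P X"
  shows "AE w in P. \<exists>n. stable_alloc I (X n w) \<and> (\<forall>k\<ge>n. X k w = X n w)"
proof -
  define R where "R = restricted_step I (data_unit I x0)"
  define T where "T = {x \<in> reachable I x0. stable_alloc I x}"
  obtain K where K: "better_response_kernel I x0 K" and mc: "markov_chain P (reachable I x0) K x0 X"
    using assms(4) by (auto simp: random_better_response_dynamics_def)
  have support: "set_pmf (K x) = (if {y. R x y} = {} then {x} else {y. R x y})"
    if "x \<in> reachable I x0" for x
    using K that unfolding better_response_kernel_def Let_def R_def by blast
  have reach: "y \<in> reachable I x0" if "x \<in> reachable I x0" "R\<^sup>*\<^sup>* x y" for x y
    using that by (auto simp: reachable_def R_def)
  have "AE w in P. \<exists>n. X n w \<in> T \<and> (\<forall>k\<ge>n. X k w = X n w)"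
  proof (rule markov_chain_absorbed[OF mc])
    show "finite (reachable I x0)" by (rule reachable_finite_and_stabilizing(1)[OF assms(1-3)])
  next
    fix t assume t: "t \<in> T"
    \<comment> \<open>No edge blocks, so no step is available and the kernel falls back to the point
      mass.\<close>
    then have "{y. R t y} = {}"
      by (auto simp: T_def R_def restricted_step_def better_response_step_def stable_alloc_def)
    with t support have "set_pmf (K t) = {t}" by (simp add: T_def)
    then have "K t = return_pmf t" by (simp add: set_pmf_subset_singleton[symmetric])
    then show "pmf (K t) t = 1" by simp
  next
    fix x assume x: "x \<in> reachable I x0"
    then obtain z where z: "R\<^sup>*\<^sup>* x z" "stable_alloc I z"
      using reachable_finite_and_stabilizing(2)[OF assms(1-3)] by (auto simp: R_def)
    have "(\<lambda>a b. 0 < pmf (K a) b)\<^sup>*\<^sup>* x z"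
      using z(1)
    proof (induction rule: rtranclp_induct)
      case (step y z)
      then have "z \<in> set_pmf (K y)" using support[OF reach[OF x step.hyps(1)]] by auto
      then have "0 < pmf (K y) z" by (simp add: pmf_positive)
      with step.IH show ?case
        by (rule rtranclp.rtrancl_into_rtrancl[of "\<lambda>a b. 0 < pmf (K a) b"])
    qed simp
    moreover have "z \<in> T" using z reach[OF x] by (simp add: T_def)
    ultimately show "\<exists>t\<in>T. (\<lambda>a b. 0 < pmf (K a) b)\<^sup>*\<^sup>* x t" by blast
  qed
  then show ?thesis by (rule AE_mp) (auto simp: T_def)
qed

end
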